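(* Let $S$ be a numerical semigroup with $S\neq \mathbb{N}$ and let $k$ be a positive integer. Then $\mathrm{C}(S)=k$ if and only if $(k-1)\,\mathrm{m}(S)<\mathrm{F}(S)<k\,\mathrm{m}(S)$.
   Context: A numerical semigroup is a subset $S\subseteq\mathbb{N}=\{0,1,2,\dots\}$ containing $0$, closed under addition, with $\mathbb{N}\setminus S$ finite. $\mathrm{F}(S)=\max(\mathbb{Z}\setminus S)$ (Frobenius number) and $\mathrm{m}(S)=\min(S\setminus\{0\})$ (multiplicity). For a numerical semigroup $\Delta$, an ideal of $\Delta$ is a nonempty $I\subseteq\Delta$ with $I+\Delta\subseteq I$. $\mathcal{J}(\Delta)$ is the set of numerical semigroups $S$ such that $S\setminus\{0\}$ is an ideal of $\Delta$; for a family $\mathscr{F}$ of numerical semigroups, $\mathcal{J}(\mathscr{F})=\bigcup_{\Delta\in\mathscr{F}}\mathcal{J}(\Delta)$. Set $\mathcal{J}^0(\mathbb{N})=\{\mathbb{N}\}$, $\mathcal{J}^1(\mathbb{N})=\mathcal{J}(\mathbb{N})$ and $\mathcal{J}^{k+1}(\mathbb{N})=\mathcal{J}(\mathcal{J}^k(\mathbb{N}))$. The complexity of a numerical semigroup $S$ is $\mathrm{C}(S)=\min\{k\in\mathbb{N}\mid S\in\mathcal{J}^k(\mathbb{N})\}$ (this set is nonempty for every numerical semigroup). *)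

theory Defs
  imports Main
begin

definition numerical_semigroup :: "nat set \<Rightarrow> bool" where
  "numerical_semigroup S \<longleftrightarrow>
     0 \<in> S \<and> (\<forall>x\<in>S. \<forall>y\<in>S. x + y \<in> S) \<and> finite (UNIV - S)"

(* The maximum is over the integers, so that the value for the full semigroup is -1.
   The complement of S in the integers is infinite (it contains all negative numbers),
   so Max is not applicable and GREATEST is used. *)
definition frobenius_number :: "nat set \<Rightarrow> int" where
  "frobenius_number S = (GREATEST z :: int. z \<notin> int ` S)"

definition multiplicity_of :: "nat set \<Rightarrow> nat" where
  "multiplicity_of S = (LEAST x. x \<in> S - {0})"

definition ideal_of :: "nat set \<Rightarrow> nat set \<Rightarrow> bool" where
  "ideal_of I \<Delta> \<longleftrightarrow>
     I \<noteq> {} \<and> I \<subseteq> \<Delta> \<and> (\<forall>x\<in>I. \<forall>y\<in>\<Delta>. x + y \<in> I)"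

definition J :: "nat set \<Rightarrow> nat set set" where
  "J \<Delta> = {S. numerical_semigroup S \<and> ideal_of (S - {0}) \<Delta>}"

definition J_family :: "nat set set \<Rightarrow> nat set set" where
  "J_family F = (\<Union>\<Delta>\<in>F. J \<Delta>)"

primrec J_iter :: "nat \<Rightarrow> nat set set" where
  "J_iter 0 = {UNIV}"
| "J_iter (Suc k) = J_family (J_iter k)"

lemma J_iter_1: "J_iter 1 = J UNIV"
  by (simp add: J_family_def)

definition complexity :: "nat set \<Rightarrow> nat" where
  "complexity S = (LEAST k. S \<in> J_iter k)"

end

(* By induction on k, a numerical semigroup S lies in J_iter k iff F(S) < k m(S).  If S - {0} is an
   ideal of D, then a gap x of S and a positive d in S satisfy x < d or x - d is a gap of D, which
   raises the bound k d by at most d.  Conversely, given F(S) < (k+1) m(S), the semigroup obtained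
   from S by adjoining every x > F(S) - m(S) has S - {0} as an ideal and satisfies the bound for k. *)
theory Submission
  imports Defs
begin

text \<open>For a numerical semigroup other than \<open>UNIV\<close> this says F(S) < k m(S).
  Ranging over all positive \<open>d\<close> in \<open>S\<close> lets a bound for \<open>D\<close>
  be used at the same \<open>d\<close> when S - {0} lies in \<open>D\<close>, although m(D) may be
  smaller than m(S). For \<open>UNIV\<close> it holds vacuously.\<close>

definition gaps_below :: "nat \<Rightarrow> nat set \<Rightarrow> bool" where
  "gaps_below k S \<longleftrightarrow> (\<forall>x. x \<notin> S \<longrightarrow> (\<forall>d\<in>S - {0}. x < k * d))"

lemma gaps_below_mono:
  assumes "gaps_below j S" and "j \<le> k"
  shows "gaps_below k S"
  using assms unfolding gaps_below_def by (meson less_le_trans mult_le_mono1)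

lemma numerical_semigroup_UNIV: "numerical_semigroup UNIV"
  by (simp add: numerical_semigroup_def)

lemma finite_gaps: "numerical_semigroup S \<Longrightarrow> finite (- S)"
  by (simp add: numerical_semigroup_def Compl_eq_Diff_UNIV)

lemma numerical_semigroup_nontrivial:
  assumes "numerical_semigroup S"
  shows "S - {0} \<noteq> {}"
proof -
  have "infinite S"
    using finite_gaps[OF assms] by (metis finite_compl infinite_UNIV_nat)
  then show ?thesis
    by (metis finite.emptyI infinite_remove)
qed

text \<open>A positive \<open>d\<close> exists in \<open>S\<close>, and x < 0 * d is impossible, so
  no gap can remain.\<close>

lemma gaps_below_0_iff:
  assumes "numerical_semigroup S"
  shows "gaps_below 0 S \<longleftrightarrow> S = UNIV"
proof
  assume "gaps_below 0 S"
  then show "S = UNIV"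
    using numerical_semigroup_nontrivial[OF assms] unfolding gaps_below_def by auto
qed (simp add: gaps_below_def)

lemma multiplicity_of_properties:
  assumes "numerical_semigroup S"
  shows "multiplicity_of S \<in> S" and "multiplicity_of S > 0"
    and "\<And>d. d \<in> S \<Longrightarrow> d > 0 \<Longrightarrow> multiplicity_of S \<le> d"
proof -
  obtain x where "x \<in> S - {0}"
    using numerical_semigroup_nontrivial[OF assms] by blast
  then have "multiplicity_of S \<in> S - {0}"
    unfolding multiplicity_of_def by (rule LeastI)
  then show "multiplicity_of S \<in> S" and "multiplicity_of S > 0" by auto
  show "multiplicity_of S \<le> d" if "d \<in> S" "d > 0" for d
    unfolding multiplicity_of_def using that by (auto intro: Least_le)
qed

text \<open>k * d grows with \<open>d\<close>, so the least positive element imposes the strongest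
  bound.\<close>

lemma gaps_below_iff_multiplicity:
  assumes "numerical_semigroup S"
  shows "gaps_below k S \<longleftrightarrow> (\<forall>x. x \<notin> S \<longrightarrow> x < k * multiplicity_of S)"
  using multiplicity_of_properties[OF assms] unfolding gaps_below_def
  by (metis DiffE DiffI empty_iff insert_iff less_le_trans less_irrefl mult_le_mono2 neq0_conv)

lemma gaps_below_J:
  assumes "S \<in> J D" and "gaps_below k D"
  shows "gaps_below (Suc k) S"
  unfolding gaps_below_def
proof (intro allI impI ballI)
  fix x d assume x: "x \<notin> S" and d: "d \<in> S - {0}"
  have ideal: "S - {0} \<subseteq> D" "\<And>y. y \<in> D \<Longrightarrow> d + y \<in> S - {0}"
    using assms(1) d unfolding J_def ideal_of_def by auto
  show "x < Suc k * d"
  proof (cases "x < d")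
    case False
    then have "x - d \<notin> D" using ideal(2)[of "x - d"] x by auto
    then have "x - d < k * d" using assms(2) d ideal(1) unfolding gaps_below_def by blast
    then show ?thesis using False by simp
  qed simp
qed

lemma ex_J_gaps_below:
  assumes S: "numerical_semigroup S" and g: "gaps_below (Suc k) S"
  obtains D where "numerical_semigroup D" and "gaps_below k D" and "S \<in> J D"
proof -
  define m where "m = multiplicity_of S"
  note m = multiplicity_of_properties[OF S, folded m_def]
  have add: "x + y \<in> S" if "x \<in> S" "y \<in> S" for x y
    using S that unfolding numerical_semigroup_def by blast
  \<comment> \<open>The condition says that x + m exceeds every gap, i.e. x > F(S) - m, without
    subtraction and also for S = \<open>UNIV\<close>.\<close>
  define D where "D = S \<union> {x. \<forall>y. y \<notin> S \<longrightarrow> y < x + m}"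
  \<comment> \<open>The adjoined set is upward closed, so only sums of two elements of
    \<open>S\<close> need the closure of \<open>S\<close>.\<close>
  have tail: "x + y \<in> D" if "x \<in> D - S" for x y
    using that unfolding D_def by (auto intro: trans_less_add1 simp: add.assoc add.commute[of y])
  have D: "numerical_semigroup D"
    unfolding numerical_semigroup_def
  proof (intro conjI ballI)
    show "0 \<in> D" using S unfolding D_def numerical_semigroup_def by blast
    show "finite (UNIV - D)"
      using S unfolding numerical_semigroup_def D_def by (auto elim: finite_subset[rotated])
    show "x + y \<in> D" if "x \<in> D" "y \<in> D" for x y
      using tail[of x y] tail[of y x] add[of x y] that
      by (cases "x \<in> S"; cases "y \<in> S") (auto simp: add.commute D_def)
  qed
  have below: "gaps_below k D"
    unfolding gaps_below_def
  proof (intro allI impI ballI)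
    fix x d assume "x \<notin> D" and d: "d \<in> D - {0}"
    \<comment> \<open>A gap \<open>x\<close> of \<open>D\<close> is witnessed by a gap
      \<open>y\<close> of \<open>S\<close> at distance at least \<open>m\<close>; this lowers the
      factor from k + 1 to k.\<close>
    then obtain y where y: "y \<notin> S" "x + m \<le> y" unfolding D_def by (auto simp: not_less)
    have "y < Suc k * m" using g m y(1) unfolding gaps_below_def by blast
    with y have xk: "x < k * m" by simp
    show "x < k * d"
    proof (cases "m \<le> d")
      case True
      then show ?thesis using xk by (meson less_le_trans mult_le_mono2)
    next
      case False
      then have "d \<notin> S" using d m(3) by auto
      \<comment> \<open>Here \<open>d\<close> is an adjoined element, so y < d + m, while x + m
        \<le> y.\<close>
      then have "x < d" using d y unfolding D_def by force
      moreover have "k > 0" using xk by (cases k) auto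
      then have "d \<le> k * d" by simp
      ultimately show ?thesis by linarith
    qed
  qed
  have "x + y \<in> S - {0}" if "x \<in> S - {0}" "y \<in> D" for x y
  proof (cases "y \<in> S")
    case False
    \<comment> \<open>Since x \<ge> m, the sum x + y lies beyond every gap of
      \<open>S\<close>.\<close>
    then have "\<forall>z. z \<notin> S \<longrightarrow> z < y + m" using that unfolding D_def by blast
    moreover have "m \<le> x" using m(3) that by auto
    ultimately show ?thesis using that(1) by force
  qed (use add that in auto)
  then have "S \<in> J D"
    using S m unfolding J_def ideal_of_def by (auto simp: D_def)
  with D below show thesis by (rule that)
qed

lemma J_iter_iff: "S \<in> J_iter k \<longleftrightarrow> numerical_semigroup S \<and> gaps_below k S"
proof (induction k arbitrary: S)
  case 0
  then show ?case using gaps_below_0_iff numerical_semigroup_UNIV by auto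
next
  case (Suc k)
  have "S \<in> J_iter (Suc k) \<longleftrightarrow> (\<exists>D. numerical_semigroup D \<and> gaps_below k D \<and> S \<in> J D)"
    by (auto simp: J_family_def Suc)
  also have "\<dots> \<longleftrightarrow> numerical_semigroup S \<and> gaps_below (Suc k) S"
    using gaps_below_J ex_J_gaps_below by (metis (no_types, lifting) J_def mem_Collect_eq)
  finally show ?case .
qed

text \<open>As \<open>S\<close> has a gap, negative integers cannot be the greatest
  non-element.\<close>

lemma frobenius_number_eq_Max:
  assumes "numerical_semigroup S" and "S \<noteq> UNIV"
  shows "frobenius_number S = int (Max (- S))"
  unfolding frobenius_number_def
proof (rule Greatest_equality)
  note fin = finite_gaps[OF assms(1)]
  have "Max (- S) \<in> - S" using fin assms(2) by (intro Max_in) auto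
  then show "int (Max (- S)) \<notin> int ` S" by auto
  fix z assume z: "z \<notin> int ` S"
  show "z \<le> int (Max (- S))"
  proof (cases "z < 0")
    case False
    then have "nat z \<in> - S" using z by force
    then show ?thesis using Max_ge[OF fin] by fastforce
  qed simp
qed

lemma gaps_below_iff_frobenius_number:
  assumes S: "numerical_semigroup S" and "S \<noteq> UNIV"
  shows "gaps_below k S \<longleftrightarrow> frobenius_number S < int (k * multiplicity_of S)"
proof -
  have "(\<forall>x. x \<notin> S \<longrightarrow> x < c) \<longleftrightarrow> Max (- S) < c" for c
    using finite_gaps[OF S] assms(2) by (subst Max_less_iff) auto
  then show ?thesis
    unfolding gaps_below_iff_multiplicity[OF S] frobenius_number_eq_Max[OF assms] of_nat_less_iff .
qed

lemma numerical_semigroup_mult: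
  assumes "numerical_semigroup S" and "x \<in> S"
  shows "n * x \<in> S"
  using assms unfolding numerical_semigroup_def by (induction n) auto

text \<open>Applied to the multiple j m(S), which lies in \<open>S\<close>, this excludes F(S) = j
  m(S) and makes the lower bound strict.\<close>

lemma frobenius_number_not_mem:
  assumes "numerical_semigroup S" and "S \<noteq> UNIV" and "x \<in> S"
  shows "frobenius_number S \<noteq> int x"
proof -
  have "Max (- S) \<in> - S" using finite_gaps[OF assms(1)] assms(2) by (intro Max_in) auto
  then show ?thesis using assms(3) frobenius_number_eq_Max[OF assms(1,2)] by auto
qed

text \<open>Any strict upper bound of the gaps serves as \<open>k\<close>, because d \<ge> 1. This
  makes the least \<open>k\<close> meaningful.\<close>

lemma ex_gaps_below:
  assumes "numerical_semigroup S"
  shows "\<exists>k. gaps_below k S"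
proof -
  obtain k where k: "\<forall>x\<in>- S. x < k"
    using finite_gaps[OF assms] finite_nat_set_iff_bounded by blast
  have "x < k * d" if "x \<notin> S" "d \<in> S - {0}" for x d
  proof -
    have "x < k" using k that(1) by simp
    also have "k \<le> k * d" using that(2) by simp
    finally show ?thesis .
  qed
  then show ?thesis unfolding gaps_below_def by blast
qed

theorem theorem21:
  fixes S :: "nat set" and k :: nat
  assumes "numerical_semigroup S" and "S \<noteq> UNIV" and "k > 0"
  shows "complexity S = k \<longleftrightarrow>
    (int k - 1) * int (multiplicity_of S) < frobenius_number S \<and>
    frobenius_number S < int k * int (multiplicity_of S)"
proof -
  obtain j where k: "k = Suc j" using assms(3) gr0_implies_Suc by blast
  have "complexity S = (LEAST k. gaps_below k S)"
    using assms(1) by (simp add: complexity_def J_iter_iff)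
  \<comment> \<open>\<open>gaps_below\<close> is monotone in its first argument, so minimality of
    \<open>k\<close> need only be tested at the predecessor \<open>j\<close>.\<close>
  also have "\<dots> = k \<longleftrightarrow> \<not> gaps_below j S \<and> gaps_below k S"
  proof
    assume "(LEAST k. gaps_below k S) = k"
    then show "\<not> gaps_below j S \<and> gaps_below k S"
      using LeastI_ex[OF ex_gaps_below[OF assms(1)]] not_less_Least[of j "\<lambda>k. gaps_below k S"] k
      by auto
  next
    assume *: "\<not> gaps_below j S \<and> gaps_below k S"
    then have "k \<le> i" if "gaps_below i S" for i
      using gaps_below_mono[OF that, of j] k not_less_eq_eq by blast
    with * show "(LEAST k. gaps_below k S) = k" by (intro Least_equality) auto
  qed
  also have "\<not> gaps_below j S \<longleftrightarrow> int (j * multiplicity_of S) < frobenius_number S"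
    using gaps_below_iff_frobenius_number[OF assms(1,2)]
      frobenius_number_not_mem[OF assms(1,2)
        numerical_semigroup_mult[OF assms(1) multiplicity_of_properties(1)[OF assms(1)]], of j]
    by auto
  finally show ?thesis
    using gaps_below_iff_frobenius_number[OF assms(1,2)] k by (simp add: algebra_simps)
qed

end
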